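(* Let $n\ge 2$ and $T\ge 1$ be integers, let $\gamma\in(0,1)$, $a>0$, $b\in\mathbb{R}$, and let $\ell_0,\ldots,\ell_{T-1}\in\mathbb{R}^n$ be an arbitrary sequence of loss vectors. Let $(x_t^{H})_{t=0}^{T-1}$ be the portfolios generated by the Hedge algorithm with parameters $\gamma,a,b$ on the losses $\ell_0,\ldots,\ell_{T-1}$. Let $(x_t^{DA})_{t=0}^{T-1}$ be the points generated by the Dual Averaging method on $Q=\Delta_n$ with prox-function $d_{\Delta_n}(x)=\ln(n)+\sum_{i=1}^n x_i\ln(x_i)$, oracle outputs $g_t=(a\ell_{t,i}+b)_{i=1}^n$, weights $\lambda_t=\ln(1/\gamma)$ and projection parameters $\beta_t=1$ for all $t$. Then $x_t^{H}=x_t^{DA}$ for every $t=0,\ldots,T-1$. That is, the Hedge algorithm is a Dual Averaging scheme.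
   Context: $\Delta_n=\{x\in\mathbb{R}^n: x\ge 0,\ \sum_{i=1}^n x_i=1\}$ is the standard simplex, $\langle\cdot,\cdot\rangle$ is the standard dot product, and $0\ln 0=0$. Hedge algorithm (parameters $\gamma\in(0,1)$, $a>0$, $b\in\mathbb{R}$): set $w_0=(1/n,\ldots,1/n)$. For $t=0,\ldots,T-1$: set $x_t=w_t/\sum_{i=1}^n w_{t,i}$, observe the loss vector $\ell_t$, and set $w_{t+1,i}=w_{t,i}\,\gamma^{a\ell_{t,i}+b}$ for $i=1,\ldots,n$. Dual Averaging method (closed convex set $Q\subset\mathbb{R}^n$, prox-function $d:Q\to\mathbb{R}$ continuous and strongly convex, positive weights $\lambda_t$, non-decreasing positive projection parameters $\beta_t$): set $s_0=0$ and $x_0=\arg\min_{x\in Q}d(x)$. For $t=0,\ldots,T-1$: receive the oracle output $g_t\in\mathbb{R}^n$, set $s_{t+1}=s_t-\lambda_t g_t$, and set $x_{t+1}=\arg\max_{x\in Q}\{\langle s_{t+1},x-x_0\rangle-\beta_{t+1}d(x)\}$. The loss vectors are arbitrary; in particular $\ell_t$ may have been chosen depending on the portfolios up to time $t$. *)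

theory Defs
  imports "HOL-Analysis.Analysis"
begin

definition std_simplex :: "(real ^ 'n) set" where
  "std_simplex = {x. (\<forall>i. 0 \<le> x $ i) \<and> (\<Sum>i\<in>UNIV. x $ i) = 1}"

primrec hedge_weights :: "real \<Rightarrow> real \<Rightarrow> real \<Rightarrow> (nat \<Rightarrow> real ^ 'n) \<Rightarrow> nat \<Rightarrow> real ^ 'n" where
  "hedge_weights \<gamma> a b l 0 = (\<chi> i. 1 / real CARD('n))"
| "hedge_weights \<gamma> a b l (Suc t) =
     (\<chi> i. hedge_weights \<gamma> a b l t $ i * \<gamma> powr (a * l t $ i + b))"

definition hedge :: "real \<Rightarrow> real \<Rightarrow> real \<Rightarrow> (nat \<Rightarrow> real ^ 'n) \<Rightarrow> nat \<Rightarrow> real ^ 'n" where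
  "hedge \<gamma> a b l t =
     (1 / (\<Sum>i\<in>UNIV. hedge_weights \<gamma> a b l t $ i)) *\<^sub>R hedge_weights \<gamma> a b l t"

(* The modulus is existentially quantified.  Since all norms on a finite-dimensional space are
   equivalent, the choice of the Euclidean norm then does not matter. *)
definition strongly_convex_on :: "'a::euclidean_space set \<Rightarrow> ('a \<Rightarrow> real) \<Rightarrow> bool" where
  "strongly_convex_on Q d \<longleftrightarrow>
     (\<exists>\<sigma>>0. \<forall>x\<in>Q. \<forall>y\<in>Q. \<forall>u\<in>{0..1}.
        d (u *\<^sub>R x + (1 - u) *\<^sub>R y)
          \<le> u * d x + (1 - u) * d y - \<sigma> / 2 * u * (1 - u) * (norm (x - y))\<^sup>2)"

definition dual_averaging_params ::
  "'a::euclidean_space set \<Rightarrow> ('a \<Rightarrow> real) \<Rightarrow> (nat \<Rightarrow> real) \<Rightarrow> (nat \<Rightarrow> real) \<Rightarrow> bool" where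
  "dual_averaging_params Q d lam \<beta> \<longleftrightarrow>
     closed Q \<and> convex Q \<and> continuous_on Q d \<and> strongly_convex_on Q d \<and>
     (\<forall>t. 0 < lam t) \<and> (\<forall>t. 0 < \<beta> t) \<and> mono \<beta>"

(* The sequences s and x are a T-step execution of the method on the oracle outputs g.  This is a
   relation because the extremal points are not presupposed to exist or to be unique.  Only the
   entries of s and x up to index T are constrained. *)
definition dual_averaging_run ::
  "'a::euclidean_space set \<Rightarrow> ('a \<Rightarrow> real) \<Rightarrow> (nat \<Rightarrow> real) \<Rightarrow> (nat \<Rightarrow> real) \<Rightarrow>
     (nat \<Rightarrow> 'a) \<Rightarrow> nat \<Rightarrow> (nat \<Rightarrow> 'a) \<Rightarrow> (nat \<Rightarrow> 'a) \<Rightarrow> bool" where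
  "dual_averaging_run Q d lam \<beta> g T s x \<longleftrightarrow>
     s 0 = 0 \<and> is_arg_min d (\<lambda>y. y \<in> Q) (x 0) \<and>
     (\<forall>t<T. s (Suc t) = s t - lam t *\<^sub>R g t \<and>
        is_arg_max (\<lambda>y. s (Suc t) \<bullet> (y - x 0) - \<beta> (Suc t) * d y) (\<lambda>y. y \<in> Q) (x (Suc t)))"

(* The product makes the value of ln at 0 irrelevant, as the convention 0 ln 0 = 0 requires. *)
definition entropy_prox :: "real ^ 'n \<Rightarrow> real" where
  "entropy_prox x = ln (real CARD('n)) + (\<Sum>i\<in>UNIV. x $ i * ln (x $ i))"

end

theory Submission
  imports Defs "HOL-Real_Asymp.Real_Asymp"
begin

text \<open>Hedge and Dual Averaging agree because the entropic prox-function turns the Dual Averaging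
  step into the softmax map. The multiplicative update says that the logarithm of the Hedge
  weights moves by \<open>(a * l t $ i + b) * ln \<gamma>\<close>, which is the Dual Averaging step
  \<open>- lam t *\<^sub>R g t\<close>. Hence \<open>ln (hedge_weights \<gamma> a b l t $ i)\<close> equals
  \<open>s t $ i\<close> up to the additive constant \<open>- ln n\<close>
  (\<open>hedge_weights_eq_exp\<close>), and normalising changes this constant only. The Hedge portfolio
  \<open>x\<close> is therefore a point of the relative interior with \<open>s t - ln x\<close> constant over
  the coordinates. This is the first-order optimality condition for maximising
  \<open>s t \<bullet> y - entropy_prox y\<close> over the simplex.

  Everything about the prox-function rests on one scalar estimate. The second derivative
  \<open>1 / p\<close> of \<open>p * ln p\<close> is at least 1 on \<open>(0, 1]\<close>, so the function lies
  above each of its tangents there by at least half the squared distance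
  (\<open>x_ln_x_above_tangent\<close>). Averaging this over two points gives strong convexity with
  modulus 1 for the Euclidean norm. Summing it over the coordinates at a point satisfying the
  optimality condition gives a quadratic gap (\<open>entropy_objective_gap\<close>), so that such a point
  is a maximiser and there is no other one.\<close>

section \<open>The scalar function \<open>p * ln p\<close>\<close>

text \<open>The difference of the two sides vanishes at \<open>p = r\<close>, and its derivative
  \<open>ln p - ln r - (p - r)\<close> has the sign of \<open>p - r\<close> because \<open>ln\<close> has slope at
  least 1 on \<open>(0, 1]\<close>.\<close>
lemma x_ln_x_above_tangent:
  fixes p r :: real
  assumes "0 \<le> p" "p \<le> 1" "0 < r" "r \<le> 1"
  shows "r * ln r + (ln r + 1) * (p - r) + (p - r)\<^sup>2 / 2 \<le> p * ln p"
proof (cases "p = 0")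
  case True
  have "r\<^sup>2 \<le> r * 1" using assms by (simp add: power2_eq_square mult_left_le)
  then show ?thesis using True assms by (simp add: algebra_simps)
next
  case False
  then have p: "0 < p" using assms by simp
  define f where "f = (\<lambda>q. q * ln q - r * ln r - (ln r + 1) * (q - r) - (q - r)\<^sup>2 / 2)"
  have df: "(f has_real_derivative (ln q - ln r - (q - r))) (at q)" if "0 < q" for q
    unfolding f_def using that by (auto intro!: derivative_eq_intros simp: field_simps)
  have slope: "v - u \<le> ln v - ln u" if "0 < u" "u \<le> v" "v \<le> 1" for u v :: real
  proof -
    have "ln (u / v) \<le> u / v - 1" using that by (intro ln_le_minus_one) auto
    moreover have "ln (u / v) = ln u - ln v" using that by (intro ln_divide_pos) auto
    moreover have "u / v - 1 \<le> u - v"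
    proof -
      have "(v - u) * v \<le> (v - u) * 1" using that by (intro mult_left_mono) auto
      then show ?thesis using that by (simp add: field_simps)
    qed
    ultimately show ?thesis by linarith
  qed
  have "f r \<le> f p"
  proof (cases "r \<le> p")
    case True
    show ?thesis
    proof (rule DERIV_nonneg_imp_nondecreasing[OF True])
      fix q assume q: "r \<le> q" "q \<le> p"
      show "\<exists>y. (f has_real_derivative y) (at q) \<and> 0 \<le> y"
        using df[of q] slope[of r q] q assms by (intro exI[of _ "ln q - ln r - (q - r)"]) auto
    qed
  next
    case False
    then have "p \<le> r" by simp
    then show ?thesis
    proof (rule DERIV_nonpos_imp_nonincreasing)
      fix q assume q: "p \<le> q" "q \<le> r"
      show "\<exists>y. (f has_real_derivative y) (at q) \<and> y \<le> 0"
        using df[of q] slope[of q r] q p assms by (intro exI[of _ "ln q - ln r - (q - r)"]) auto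
    qed
  qed
  then show ?thesis unfolding f_def by simp
qed

text \<open>The tangent at the intermediate point is used for both end points; the linear terms cancel
  in the convex combination. There is no tangent at \<open>m = 0\<close>, but then each end point either
  is 0 or has weight 0.\<close>
lemma x_ln_x_strongly_convex:
  fixes p q u :: real
  assumes "0 \<le> p" "p \<le> 1" "0 \<le> q" "q \<le> 1" "0 \<le> u" "u \<le> 1"
  defines "m \<equiv> u * p + (1 - u) * q"
  shows "m * ln m \<le> u * (p * ln p) + (1 - u) * (q * ln q) - u * (1 - u) * (p - q)\<^sup>2 / 2"
proof (cases "m = 0")
  case True
  have "0 \<le> u * p" "0 \<le> (1 - u) * q" using assms by auto
  then have "u * p = 0" "(1 - u) * q = 0" using True unfolding m_def by linarith+
  then show ?thesis using True by auto
next
  case False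
  have "0 \<le> m" unfolding m_def using assms by simp
  then have m0: "0 < m" using False by simp
  have "u * p \<le> u * 1" "(1 - u) * q \<le> (1 - u) * 1" using assms by (intro mult_left_mono; simp)+
  then have m1: "m \<le> 1" unfolding m_def by simp
  have P: "u * (m * ln m + (ln m + 1) * (p - m) + (p - m)\<^sup>2 / 2) \<le> u * (p * ln p)"
    using x_ln_x_above_tangent[of p m] assms m0 m1 by (intro mult_left_mono) auto
  have Q: "(1 - u) * (m * ln m + (ln m + 1) * (q - m) + (q - m)\<^sup>2 / 2) \<le> (1 - u) * (q * ln q)"
    using x_ln_x_above_tangent[of q m] assms m0 m1 by (intro mult_left_mono) auto
  have "u * (m * ln m + (ln m + 1) * (p - m) + (p - m)\<^sup>2 / 2)
      + (1 - u) * (m * ln m + (ln m + 1) * (q - m) + (q - m)\<^sup>2 / 2)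
      = m * ln m + (ln m + 1) * (u * p + (1 - u) * q - m)
        + (u * (p - m)\<^sup>2 + (1 - u) * (q - m)\<^sup>2) / 2"
    by (simp add: field_simps)
  also have "\<dots> = m * ln m + u * (1 - u) * (p - q)\<^sup>2 / 2"
    unfolding m_def by (simp add: power2_eq_square field_simps)
  finally show ?thesis using P Q by linarith
qed

lemma continuous_on_x_ln_x: "continuous_on {0..} (\<lambda>p::real. p * ln p)"
  unfolding continuous_on_eq_continuous_within
proof
  fix p :: real assume "p \<in> {0..}"
  then consider "p = 0" | "0 < p" by fastforce
  then show "continuous (at p within {0..}) (\<lambda>p. p * ln p)"
  proof cases
    case 1
    have "((\<lambda>p::real. p * ln p) \<longlongrightarrow> 0) (at_right 0)" by real_asymp
    then show ?thesis
      using 1 by (simp add: continuous_within at_within_Ici_at_right)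
  next
    case 2
    then show ?thesis by (intro continuous_intros) auto
  qed
qed

section \<open>The entropic prox-function on the simplex\<close>

lemma closed_std_simplex: "closed (std_simplex :: (real ^ 'n) set)"
proof -
  have "std_simplex = (\<Inter>i. {x :: real ^ 'n. 0 \<le> x $ i}) \<inter> {x. (\<Sum>i\<in>UNIV. x $ i) = 1}"
    unfolding std_simplex_def by auto
  also have "closed \<dots>"
    by (intro closed_Int closed_INT ballI closed_Collect_le closed_Collect_eq continuous_intros)
  finally show ?thesis .
qed

lemma convex_std_simplex: "convex (std_simplex :: (real ^ 'n) set)"
  unfolding convex_def std_simplex_def
  by (auto simp: sum.distrib simp flip: sum_distrib_left)

lemma std_simplex_nth_le_1: "x \<in> std_simplex \<Longrightarrow> x $ i \<le> 1"
  unfolding std_simplex_def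
  using member_le_sum[of i UNIV "\<lambda>i. x $ i"] by auto

lemma continuous_on_entropy_prox: "continuous_on (std_simplex :: (real ^ 'n) set) entropy_prox"
  unfolding entropy_prox_def
proof (intro continuous_on_add continuous_on_const continuous_on_sum)
  fix i :: 'n
  show "continuous_on std_simplex (\<lambda>x :: real ^ 'n. x $ i * ln (x $ i))"
    by (rule continuous_on_compose2[OF continuous_on_x_ln_x])
      (auto intro!: continuous_intros simp: std_simplex_def)
qed

lemma norm_vec_power2: "(norm (x :: real ^ 'n))\<^sup>2 = (\<Sum>i\<in>UNIV. (x $ i)\<^sup>2)"
  unfolding power2_norm_eq_inner inner_vec_def by (simp add: power2_eq_square)

lemma strongly_convex_on_entropy_prox:
  "strongly_convex_on (std_simplex :: (real ^ 'n) set) entropy_prox"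
  unfolding strongly_convex_on_def
proof (intro exI[of _ 1] conjI ballI)
  fix x y :: "real ^ 'n" and u :: real
  assume x: "x \<in> std_simplex" and y: "y \<in> std_simplex" and u: "u \<in> {0..1}"
  let ?m = "u *\<^sub>R x + (1 - u) *\<^sub>R y"
  have "(\<Sum>i\<in>UNIV. ?m $ i * ln (?m $ i)) \<le>
      (\<Sum>i\<in>UNIV. u * (x $ i * ln (x $ i)) + (1 - u) * (y $ i * ln (y $ i))
        - u * (1 - u) * (x $ i - y $ i)\<^sup>2 / 2)"
    using x_ln_x_strongly_convex[of "x $ i" "y $ i" u for i] x y u
      std_simplex_nth_le_1[OF x] std_simplex_nth_le_1[OF y]
    by (intro sum_mono) (simp add: std_simplex_def)
  also have "\<dots> = u * (\<Sum>i\<in>UNIV. x $ i * ln (x $ i)) + (1 - u) * (\<Sum>i\<in>UNIV. y $ i * ln (y $ i))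
      - 1 / 2 * u * (1 - u) * (norm (x - y))\<^sup>2"
    by (simp add: norm_vec_power2 sum.distrib sum_subtractf sum_distrib_left mult.assoc)
  finally show "entropy_prox ?m \<le> u * entropy_prox x + (1 - u) * entropy_prox y
      - 1 / 2 * u * (1 - u) * (norm (x - y))\<^sup>2"
    unfolding entropy_prox_def by (simp add: algebra_simps)
qed simp

text \<open>The hypothesis on \<open>s\<close> is the Lagrange condition for the constraint that the coordinates
  sum to 1: up to multiples of the all-ones vector, which pair to 0 with \<open>y - x\<close>, the gradient
  of the entropy at \<open>x\<close> is \<open>s\<close>.\<close>
lemma entropy_objective_gap:
  fixes x y s :: "real ^ 'n"
  assumes x: "x \<in> std_simplex" and y: "y \<in> std_simplex"
    and pos: "\<And>i. 0 < x $ i" and s: "\<And>i. s $ i = ln (x $ i) + c"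
  shows "s \<bullet> y - entropy_prox y + (norm (y - x))\<^sup>2 / 2 \<le> s \<bullet> x - entropy_prox x"
proof -
  have sum0: "(\<Sum>i\<in>UNIV. y $ i - x $ i) = 0"
    using x y by (simp add: std_simplex_def sum_subtractf)
  have "s \<bullet> (y - x) = (\<Sum>i\<in>UNIV. (ln (x $ i) + 1) * (y $ i - x $ i) + (c - 1) * (y $ i - x $ i))"
    unfolding inner_vec_def by (intro sum.cong) (auto simp: s algebra_simps)
  also have "\<dots> = (\<Sum>i\<in>UNIV. (ln (x $ i) + 1) * (y $ i - x $ i))"
    using sum0 by (simp add: sum.distrib flip: sum_distrib_left)
  finally have lin: "s \<bullet> (y - x) = (\<Sum>i\<in>UNIV. (ln (x $ i) + 1) * (y $ i - x $ i))" .
  have "(\<Sum>i\<in>UNIV. x $ i * ln (x $ i) + (ln (x $ i) + 1) * (y $ i - x $ i) + (y $ i - x $ i)\<^sup>2 / 2)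
      \<le> (\<Sum>i\<in>UNIV. y $ i * ln (y $ i))"
    using y pos std_simplex_nth_le_1[OF x] std_simplex_nth_le_1[OF y]
    by (intro sum_mono x_ln_x_above_tangent) (auto simp: std_simplex_def)
  then have "entropy_prox x + s \<bullet> (y - x) + (norm (y - x))\<^sup>2 / 2 \<le> entropy_prox y"
    unfolding lin entropy_prox_def norm_vec_power2 by (simp add: sum.distrib sum_divide_distrib)
  then show ?thesis by (simp add: inner_diff_right)
qed

lemma entropy_is_arg_max_iff:
  fixes x s v :: "real ^ 'n"
  assumes "x \<in> std_simplex" "\<And>i. 0 < x $ i" "\<And>i. s $ i = ln (x $ i) + c"
  shows "is_arg_max (\<lambda>y. s \<bullet> (y - v) - entropy_prox y) (\<lambda>y. y \<in> std_simplex) z \<longleftrightarrow> z = x"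
proof
  assume "is_arg_max (\<lambda>y. s \<bullet> (y - v) - entropy_prox y) (\<lambda>y. y \<in> std_simplex) z"
  then have z: "z \<in> std_simplex"
    and "s \<bullet> (x - v) - entropy_prox x \<le> s \<bullet> (z - v) - entropy_prox z"
    using assms(1) by (auto simp: is_arg_max_linorder)
  then have "(norm (z - x))\<^sup>2 \<le> 0"
    using entropy_objective_gap[OF assms(1) z assms(2,3)] unfolding inner_diff_right by linarith
  then show "z = x" by simp
next
  assume "z = x"
  moreover have "s \<bullet> y - entropy_prox y \<le> s \<bullet> x - entropy_prox x" if "y \<in> std_simplex" for y
    using entropy_objective_gap[OF assms(1) that assms(2,3)] zero_le_power2[of "norm (y - x)"]
    by linarith
  ultimately show "is_arg_max (\<lambda>y. s \<bullet> (y - v) - entropy_prox y) (\<lambda>y. y \<in> std_simplex) z"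
    using assms(1) by (simp add: is_arg_max_linorder inner_diff_right)
qed

section \<open>Hedge as a sequence of maximisers\<close>

lemma hedge_weights_eq_exp:
  fixes l s :: "nat \<Rightarrow> real ^ 'n"
  assumes "0 < \<gamma>" "s 0 = 0"
    and "\<forall>t<T. s (Suc t) = s t - ln (1 / \<gamma>) *\<^sub>R (\<chi> i. a * l t $ i + b)"
    and "t \<le> T"
  shows "hedge_weights \<gamma> a b l t $ i = exp (s t $ i) / real CARD('n)"
  using \<open>t \<le> T\<close>
proof (induction t)
  case 0
  then show ?case using assms(2) by simp
next
  case (Suc t)
  have "s (Suc t) $ i = s t $ i + (a * l t $ i + b) * ln \<gamma>"
    using Suc.prems assms(1,3) by (simp add: ln_div algebra_simps)
  then show ?case using Suc assms(1) by (simp add: powr_def exp_add)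
qed

lemma is_arg_max_iff_hedge:
  fixes l s :: "nat \<Rightarrow> real ^ 'n"
  assumes "0 < \<gamma>" "s 0 = 0"
    and "\<forall>t<T. s (Suc t) = s t - ln (1 / \<gamma>) *\<^sub>R (\<chi> i. a * l t $ i + b)"
    and "t \<le> T"
  shows "is_arg_max (\<lambda>y. s t \<bullet> (y - v) - entropy_prox y) (\<lambda>y. y \<in> std_simplex) z
    \<longleftrightarrow> z = hedge \<gamma> a b l t"
proof -
  define W where "W = (\<Sum>i\<in>UNIV. hedge_weights \<gamma> a b l t $ i)"
  note w = hedge_weights_eq_exp[where s = s, OF assms]
  have W: "0 < W" unfolding W_def w by (intro sum_pos) auto
  have h: "hedge \<gamma> a b l t $ i = hedge_weights \<gamma> a b l t $ i / W" for i
    unfolding hedge_def W_def by simp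
  have pos: "0 < hedge \<gamma> a b l t $ i" for i
    unfolding h using W by (simp add: w)
  have "(\<Sum>i\<in>UNIV. hedge \<gamma> a b l t $ i) = 1"
    unfolding h using W by (simp add: W_def flip: sum_divide_distrib)
  then have simplex: "hedge \<gamma> a b l t \<in> std_simplex"
    using pos by (simp add: std_simplex_def less_imp_le)
  have "s t $ i = ln (hedge \<gamma> a b l t $ i) + ln (real CARD('n) * W)" for i
    unfolding h using W by (simp add: w ln_div ln_mult)
  from entropy_is_arg_max_iff[OF simplex pos this] show ?thesis .
qed

text \<open>The initial point fits the same pattern as the later ones: minimising the prox-function is
  the maximisation with \<open>s 0 = 0\<close>.\<close>
lemma dual_averaging_run_iff_hedge:
  fixes l s x :: "nat \<Rightarrow> real ^ 'n"
  assumes "0 < \<gamma>"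
  shows "dual_averaging_run std_simplex entropy_prox (\<lambda>_. ln (1 / \<gamma>)) (\<lambda>_. 1)
      (\<lambda>t. \<chi> i. a * l t $ i + b) T s x \<longleftrightarrow>
    s 0 = 0 \<and> (\<forall>t<T. s (Suc t) = s t - ln (1 / \<gamma>) *\<^sub>R (\<chi> i. a * l t $ i + b)) \<and>
    (\<forall>t\<le>T. x t = hedge \<gamma> a b l t)"
proof -
  have *: "dual_averaging_run std_simplex entropy_prox (\<lambda>_. ln (1 / \<gamma>)) (\<lambda>_. 1)
      (\<lambda>t. \<chi> i. a * l t $ i + b) T s x \<longleftrightarrow>
    s 0 = 0 \<and> (\<forall>t<T. s (Suc t) = s t - ln (1 / \<gamma>) *\<^sub>R (\<chi> i. a * l t $ i + b)) \<and>
    (\<forall>t\<le>T. is_arg_max (\<lambda>y. s t \<bullet> (y - x 0) - entropy_prox y) (\<lambda>y. y \<in> std_simplex) (x t))"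
    unfolding dual_averaging_run_def
    using less_Suc_eq_0_disj less_Suc_eq_le
    by (auto simp: is_arg_max_def is_arg_min_def)
  show ?thesis
    unfolding * using is_arg_max_iff_hedge[OF assms, of s T a l b] by blast
qed

theorem mainTheorem1:
  fixes \<gamma> a b :: real and l :: "nat \<Rightarrow> real ^ 'n" and T :: nat
    and g :: "nat \<Rightarrow> real ^ 'n" and lam \<beta> :: "nat \<Rightarrow> real"
  assumes "CARD('n) \<ge> 2" and "T \<ge> 1"
    and "0 < \<gamma>" and "\<gamma> < 1" and "a > 0"
    and "\<And>t. g t = (\<chi> i. a * l t $ i + b)"
    and "\<And>t. lam t = ln (1 / \<gamma>)"
    and "\<And>t. \<beta> t = 1"
  shows "dual_averaging_params (std_simplex :: (real ^ 'n) set) entropy_prox lam \<beta> \<and>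
    (\<exists>s x. dual_averaging_run std_simplex entropy_prox lam \<beta> g T s x) \<and>
    (\<forall>s x. dual_averaging_run std_simplex entropy_prox lam \<beta> g T s x
        \<longrightarrow> (\<forall>t<T. hedge \<gamma> a b l t = x t))"
proof -
  have eqs: "lam = (\<lambda>_. ln (1 / \<gamma>))" "\<beta> = (\<lambda>_. 1)" "g = (\<lambda>t. \<chi> i. a * l t $ i + b)"
    using assms(6-8) by (intro ext; simp)+
  have "0 < ln (1 / \<gamma>)" using assms by (intro ln_gt_zero) simp
  then have params: "dual_averaging_params (std_simplex :: (real ^ 'n) set) entropy_prox lam \<beta>"
    unfolding dual_averaging_params_def eqs
    by (simp add: closed_std_simplex convex_std_simplex continuous_on_entropy_prox
        strongly_convex_on_entropy_prox monoI)
  have "dual_averaging_run std_simplex entropy_prox lam \<beta> g T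
      (\<lambda>t. - (\<Sum>k<t. lam k *\<^sub>R g k)) (hedge \<gamma> a b l)"
    unfolding eqs dual_averaging_run_iff_hedge[OF \<open>0 < \<gamma>\<close>] by simp
  moreover have "\<forall>t<T. hedge \<gamma> a b l t = x t"
    if "dual_averaging_run std_simplex entropy_prox lam \<beta> g T s x" for s x
    using that unfolding eqs dual_averaging_run_iff_hedge[OF \<open>0 < \<gamma>\<close>] by simp
  ultimately show ?thesis using params by blast
qed

end
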